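(* Let $m\in\mathbb{R}$ with $m\neq1$, and let $\psi$ be real analytic near $0$ with $\psi(0)=0$ and $\psi'(0)\neq0$. Then for the planar vector field $$X:\qquad \dot x=\tfrac{1-m}{2}x^2+\psi(y),\qquad \dot y=-xy,$$ the origin is automatically an isolated nilpotent equilibrium of rank one (i.e. $DX(0)$ is nilpotent of rank one), with $$a=0,\qquad b=-m,\qquad \mu_0=3 .$$
   Context: Here $\ker DX(0)$ is spanned by $q_0=(1,0)^T$, and $a=-\tfrac12D_{q_0}(\det DX)(0)$, $b=D_{q_0}(\operatorname{tr}DX)(0)$, where $D_qh(p)=\langle\nabla h(p),q\rangle$. The local multiplicity is $\mu_0=\dim_{\mathbb{C}}\mathbb{C}\{x,y\}/(F_1,F_2)$, where $F_1,F_2$ are the two components of $X$ and $\mathbb{C}\{x,y\}$ is the ring of convergent power series. *)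

theory Defs
  imports "HOL-Analysis.Analysis" "HOL-Algebra.Embedded_Algebras" "HOL-Algebra.QuotRing"
begin

definition jac :: "(real^2 \<Rightarrow> real^2) \<Rightarrow> real^2 \<Rightarrow> real^2^2" where
  "jac X p = jacobian X (at p)"

definition isolated_equilibrium :: "(real^2 \<Rightarrow> real^2) \<Rightarrow> real^2 \<Rightarrow> bool" where
  "isolated_equilibrium X p \<longleftrightarrow> p isolated_in {q. X q = 0}"

definition nilpotent_matrix :: "real^'n^'n \<Rightarrow> bool" where
  "nilpotent_matrix A \<longleftrightarrow> (\<exists>k. (((**) A) ^^ k) (mat 1) = 0)"

definition gradient :: "(real^2 \<Rightarrow> real) \<Rightarrow> real^2 \<Rightarrow> real^2" where
  "gradient h p = (THE g. GDERIV h p :> g)"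

definition dir_deriv :: "real^2 \<Rightarrow> (real^2 \<Rightarrow> real) \<Rightarrow> real^2 \<Rightarrow> real" where
  "dir_deriv q h p = gradient h p \<bullet> q"

definition a_coeff :: "(real^2 \<Rightarrow> real^2) \<Rightarrow> real^2 \<Rightarrow> real" where
  "a_coeff X q = - (1/2) * dir_deriv q (\<lambda>p. det (jac X p)) 0"

definition b_coeff :: "(real^2 \<Rightarrow> real^2) \<Rightarrow> real^2 \<Rightarrow> real" where
  "b_coeff X q = dir_deriv q (\<lambda>p. trace (jac X p)) 0"

text \<open>
  A power series in \<open>x, y\<close> is an element of \<^typ>\<open>complex fps fps\<close>; the coefficient of
  \<open>x\<^sup>i y\<^sup>j\<close> in \<open>P\<close> is \<open>P $ i $ j\<close>, i.e. the outer variable is \<open>x\<close>. Convergence means absolute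
  convergence on some polydisc around \<open>0\<close>.
\<close>

definition convergent_fps2 :: "complex fps fps \<Rightarrow> bool" where
  "convergent_fps2 P \<longleftrightarrow>
     (\<exists>r>0. (\<lambda>(i, j). norm (fps_nth (fps_nth P i) j) * r ^ (i + j)) summable_on UNIV)"

definition conv_series_ring :: "complex fps fps ring" where
  "conv_series_ring =
     \<lparr>carrier = {P. convergent_fps2 P}, mult = (*), one = 1, zero = 0, add = (+)\<rparr>"

definition has_conv_expansion2 :: "(real^2 \<Rightarrow> real) \<Rightarrow> complex fps fps \<Rightarrow> bool" where
  "has_conv_expansion2 f P \<longleftrightarrow> convergent_fps2 P \<and>
     (\<forall>\<^sub>F p in nhds 0.
        ((\<lambda>(i, j). fps_nth (fps_nth P i) j * of_real ((p $ 1) ^ i * (p $ 2) ^ j))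
           has_sum of_real (f p)) UNIV)"

text \<open>
  \<open>has_local_multiplicity X n\<close> says that the quotient of the ring of convergent power series by
  the ideal generated by the (unique) expansions of the components of \<open>X\<close> at the origin has
  complex dimension exactly \<open>n\<close>; in particular the dimension is finite. The scalar field
  is the image of the constant series in the quotient. Being a relation, it avoids an
  arbitrary value where the dimension is infinite.
\<close>

definition quotient_scalars :: "complex fps fps set \<Rightarrow> complex fps fps set set" where
  "quotient_scalars I = range (\<lambda>c. I +>\<^bsub>conv_series_ring\<^esub> fps_const (fps_const c))"

definition has_local_multiplicity :: "(real^2 \<Rightarrow> real^2) \<Rightarrow> nat \<Rightarrow> bool" where
  "has_local_multiplicity X n \<longleftrightarrow>
     (\<exists>F\<^sub>1 F\<^sub>2. has_conv_expansion2 (\<lambda>p. X p $ 1) F\<^sub>1 \<and> has_conv_expansion2 (\<lambda>p. X p $ 2) F\<^sub>2 \<and>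
        (let I = Idl\<^bsub>conv_series_ring\<^esub> {F\<^sub>1, F\<^sub>2}; Q = conv_series_ring Quot I
         in ring.dimension Q n (quotient_scalars I) (carrier Q)))"

definition planar_field :: "real \<Rightarrow> (real \<Rightarrow> real) \<Rightarrow> real^2 \<Rightarrow> real^2" where
  "planar_field m \<psi> p = vector [(1 - m) / 2 * (p $ 1)\<^sup>2 + \<psi> (p $ 2), - (p $ 1 * p $ 2)]"

end

theory Submission
  imports Defs
begin

text \<open>
  Near the origin the Jacobian of \<open>X = ((1 - m) / 2 x\<^sup>2 + \<psi>(y), - x y)\<close> has the rows
  \<open>((1 - m) x, \<psi>'(y))\<close> and \<open>(- y, - x)\<close>. At the origin only the entry \<open>\<psi>'(0) \<noteq> 0\<close> survives,
  so the matrix is nilpotent of rank one with kernel spanned by \<open>(1, 0)\<close>. Its trace is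
  \<open>- m x\<close> and its determinant \<open>- (1 - m) x\<^sup>2 + y \<psi>'(y)\<close>; differentiation along \<open>(1, 0)\<close>
  yields \<open>b = - m\<close> and \<open>a = 0\<close>. An equilibrium lies on one of the axes, because \<open>x y = 0\<close>; on
  \<open>x = 0\<close> it is a zero of \<open>\<psi>\<close>, which is simple at \<open>0\<close>, and on \<open>y = 0\<close> it is a zero of \<open>x\<^sup>2\<close>,
  because \<open>m \<noteq> 1\<close>. Hence the origin is isolated.

  For the multiplicity put \<open>c = (1 - m) / 2\<close>. The relations \<open>x y = 0\<close> and \<open>c x\<^sup>2 + \<psi>(y) = 0\<close>
  allow \<open>y\<close> to be eliminated in favour of \<open>x\<^sup>2\<close> and force \<open>x\<^sup>3 = 0\<close>, so that \<open>1, x, x\<^sup>2\<close> is a basis of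
  the local algebra. Lemma \<open>ideal_of_field_components\<close> makes this precise by describing the
  ideal as the common kernel of three linear functionals. It needs actual division in the ring of
  convergent series, whose closure properties rest on the coefficient estimate
  \<open>convergent_fps2_iff_geometric_bound\<close>. Lemma \<open>dimension_quotient_by_functionals\<close> turns
  the three functionals and their dual family \<open>1, x, x\<^sup>2\<close> into the dimension \<open>3\<close>.
\<close>

section \<open>Convergent double power series\<close>

text \<open>
  Absolute convergence on some polydisc is the same as geometric growth of the coefficients
  (Cauchy estimates in one direction, comparison with a geometric series on a polydisc of half
  the radius in the other). Growth bounds are easy to propagate through products, shifts and
  restrictions to an axis, so the closure properties below are derived from them.
\<close>

lemma convergent_fps2_iff_geometric_bound:
  "convergent_fps2 P \<longleftrightarrow>
     (\<exists>C M. M > 0 \<and> (\<forall>i j. norm (fps_nth (fps_nth P i) j) \<le> C * M ^ (i + j)))"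
proof
  assume "convergent_fps2 P"
  then obtain r where r: "r > 0"
    and s: "(\<lambda>(i, j). norm (fps_nth (fps_nth P i) j) * r ^ (i + j)) summable_on UNIV"
      (is "?f summable_on _")
    unfolding convergent_fps2_def by blast
  have "norm (fps_nth (fps_nth P i) j) \<le> infsum ?f UNIV * (1 / r) ^ (i + j)" for i j
  proof -
    have "sum ?f {(i, j)} \<le> infsum ?f UNIV"
      using r by (intro finite_sum_le_infsum[OF s]) auto
    with r show ?thesis by (simp add: field_simps power_add)
  qed
  with r show "\<exists>C M. M > 0 \<and> (\<forall>i j. norm (fps_nth (fps_nth P i) j) \<le> C * M ^ (i + j))"
    by (intro exI[of _ "infsum ?f UNIV"] exI[of _ "1 / r"]) auto
next
  assume "\<exists>C M. M > 0 \<and> (\<forall>i j. norm (fps_nth (fps_nth P i) j) \<le> C * M ^ (i + j))"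
  then obtain C M where M: "M > 0"
    and bound: "\<And>i j. norm (fps_nth (fps_nth P i) j) \<le> C * M ^ (i + j)"
    by blast
  \<comment> \<open>At this radius the bound becomes a double geometric series of ratio 1/2.\<close>
  define r where "r = 1 / (2 * M)"
  have geom: "(\<lambda>n. (1 / 2 :: real) ^ n) summable_on UNIV"
    by (simp add: summable_on_UNIV_nonneg_real_iff)
  have geom2: "(\<lambda>(i, j). \<bar>C\<bar> * (1 / 2 :: real) ^ i * (1 / 2) ^ j) summable_on (UNIV \<times> UNIV)"
  proof (rule summable_on_SigmaI)
    show "((\<lambda>j. case (i, j) of (i, j) \<Rightarrow> \<bar>C\<bar> * (1 / 2 :: real) ^ i * (1 / 2) ^ j)
        has_sum (\<bar>C\<bar> * (1 / 2) ^ i * infsum (\<lambda>j. (1 / 2) ^ j) UNIV)) UNIV" for i :: nat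
      using geom by (auto intro!: has_sum_cmult_right)
    show "(\<lambda>i. \<bar>C\<bar> * (1 / 2) ^ i * infsum (\<lambda>j. (1 / 2 :: real) ^ j) (UNIV :: nat set))
        summable_on (UNIV :: nat set)"
      by (intro summable_on_cmult_left summable_on_cmult_right geom)
  qed auto
  have dom: "norm (fps_nth (fps_nth P i) j) * r ^ (i + j) \<le> \<bar>C\<bar> * (1 / 2) ^ i * (1 / 2) ^ j" for i j
  proof -
    have "norm (fps_nth (fps_nth P i) j) * r ^ (i + j) \<le> C * M ^ (i + j) * r ^ (i + j)"
      using M by (intro mult_right_mono bound) (auto simp: r_def)
    also have "\<dots> = C * (M * r) ^ (i + j)"
      by (simp add: power_mult_distrib)
    also have "\<dots> = C * ((1 / 2) ^ i * (1 / 2) ^ j)"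
      using M by (simp add: r_def power_add)
    also have "\<dots> \<le> \<bar>C\<bar> * ((1 / 2) ^ i * (1 / 2) ^ j)"
      by (intro mult_right_mono) auto
    finally show ?thesis by (simp add: mult.assoc)
  qed
  have summ: "(\<lambda>(i, j). norm (fps_nth (fps_nth P i) j) * r ^ (i + j)) summable_on (UNIV \<times> UNIV)"
  proof (rule summable_on_comparison_test[OF geom2])
    fix p :: "nat \<times> nat"
    obtain i j where p: "p = (i, j)" by (cases p)
    show "(case p of (i, j) \<Rightarrow> norm (fps_nth (fps_nth P i) j) * r ^ (i + j))
        \<le> (case p of (i, j) \<Rightarrow> \<bar>C\<bar> * (1 / 2) ^ i * (1 / 2) ^ j)"
      using dom[of i j] by (simp only: p prod.case)
    show "0 \<le> (case p of (i, j) \<Rightarrow> norm (fps_nth (fps_nth P i) j) * r ^ (i + j))"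
      using M by (simp add: p r_def)
  qed
  have "r > 0" using M by (simp add: r_def)
  with summ show "convergent_fps2 P"
    unfolding convergent_fps2_def UNIV_Times_UNIV by blast
qed

lemma convergent_fps2I:
  assumes "M > 0" and "\<And>i j. norm (fps_nth (fps_nth P i) j) \<le> C * M ^ (i + j)"
  shows "convergent_fps2 P"
  unfolding convergent_fps2_iff_geometric_bound using assms by blast

text \<open>
  The bound is stated for every larger base \<open>N\<close>, so that two series can be compared with the
  same base.
\<close>

lemma convergent_fps2E:
  assumes "convergent_fps2 P"
  obtains C M where "C > 0" and "M \<ge> 1"
    and "\<And>N i j. N \<ge> M \<Longrightarrow> norm (fps_nth (fps_nth P i) j) \<le> C * N ^ (i + j)"
proof -
  obtain C M where M: "M > 0"
    and bound: "\<And>i j. norm (fps_nth (fps_nth P i) j) \<le> C * M ^ (i + j)"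
    using assms unfolding convergent_fps2_iff_geometric_bound by blast
  have "norm (fps_nth (fps_nth P i) j) \<le> max C 1 * N ^ (i + j)" if "N \<ge> max M 1" for N i j
  proof -
    have "C * M ^ (i + j) \<le> max C 1 * N ^ (i + j)"
      using M that by (intro mult_mono power_mono) auto
    with bound[of i j] show ?thesis by linarith
  qed
  then show ?thesis by (intro that[of "max C 1" "max M 1"]) auto
qed

lemma convergent_fps2_add:
  assumes "convergent_fps2 P" and "convergent_fps2 Q"
  shows "convergent_fps2 (P + Q)"
proof -
  obtain C M where "C > 0" "M \<ge> 1"
    and P: "\<And>N i j. N \<ge> M \<Longrightarrow> norm (fps_nth (fps_nth P i) j) \<le> C * N ^ (i + j)"
    using assms(1) by (rule convergent_fps2E) blast
  obtain D L where "D > 0" "L \<ge> 1"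
    and Q: "\<And>N i j. N \<ge> L \<Longrightarrow> norm (fps_nth (fps_nth Q i) j) \<le> D * N ^ (i + j)"
    using assms(2) by (rule convergent_fps2E) blast
  show ?thesis
  proof (rule convergent_fps2I)
    show "max M L > 0" using \<open>M \<ge> 1\<close> by simp
    show "norm (fps_nth (fps_nth (P + Q) i) j) \<le> (C + D) * max M L ^ (i + j)" for i j
    proof -
      have "norm (fps_nth (fps_nth (P + Q) i) j)
          \<le> norm (fps_nth (fps_nth P i) j) + norm (fps_nth (fps_nth Q i) j)"
        by (simp add: norm_triangle_ineq)
      also have "\<dots> \<le> C * max M L ^ (i + j) + D * max M L ^ (i + j)"
        by (intro add_mono P Q) auto
      finally show ?thesis by (simp add: distrib_right)
    qed
  qed
qed

text \<open>
  A coefficient of the product is a sum of \<open>(i + 1) (j + 1)\<close> terms, each of size at most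
  \<open>C D N\<^sup>i\<^sup>+\<^sup>j\<close>; since \<open>(i + 1) (j + 1) \<le> 2\<^sup>i\<^sup>+\<^sup>j\<close>, doubling the base absorbs their number.
\<close>

lemma convergent_fps2_mult:
  assumes "convergent_fps2 P" and "convergent_fps2 Q"
  shows "convergent_fps2 (P * Q)"
proof -
  obtain C M where "C > 0" "M \<ge> 1"
    and P: "\<And>N i j. N \<ge> M \<Longrightarrow> norm (fps_nth (fps_nth P i) j) \<le> C * N ^ (i + j)"
    using assms(1) by (rule convergent_fps2E) blast
  obtain D L where "D > 0" "L \<ge> 1"
    and Q: "\<And>N i j. N \<ge> L \<Longrightarrow> norm (fps_nth (fps_nth Q i) j) \<le> D * N ^ (i + j)"
    using assms(2) by (rule convergent_fps2E) blast
  define N where "N = max M L"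
  have N: "N \<ge> M" "N \<ge> L" "N > 0" using \<open>M \<ge> 1\<close> by (auto simp: N_def)
  show ?thesis
  proof (rule convergent_fps2I)
    show "2 * N > 0" using N by simp
    show "norm (fps_nth (fps_nth (P * Q) i) j) \<le> (C * D) * (2 * N) ^ (i + j)" for i j
    proof -
      have term_bound: "norm (fps_nth (fps_nth P a) b * fps_nth (fps_nth Q (i - a)) (j - b))
          \<le> (C * D) * N ^ (i + j)" if "a \<le> i" "b \<le> j" for a b
      proof -
        have "norm (fps_nth (fps_nth P a) b * fps_nth (fps_nth Q (i - a)) (j - b))
            \<le> (C * N ^ (a + b)) * (D * N ^ ((i - a) + (j - b)))"
          unfolding norm_mult using P[of N a b] Q[of N "i - a" "j - b"] N \<open>C > 0\<close>
          by (intro mult_mono) auto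
        also have "\<dots> = (C * D) * N ^ ((a + b) + ((i - a) + (j - b)))"
          by (simp add: power_add)
        also have "(a + b) + ((i - a) + (j - b)) = i + j" using that by simp
        finally show ?thesis .
      qed
      have "norm (fps_nth (fps_nth (P * Q) i) j) =
          norm (\<Sum>a=0..i. \<Sum>b=0..j. fps_nth (fps_nth P a) b * fps_nth (fps_nth Q (i - a)) (j - b))"
        by (simp add: fps_mult_nth fps_sum_nth)
      also have "\<dots> \<le> (\<Sum>a=0..i. \<Sum>b=0..j. (C * D) * N ^ (i + j))"
        by (intro sum_norm_le term_bound) auto
      also have "\<dots> = (C * D) * N ^ (i + j) * (real (Suc i) * real (Suc j))"
        by simp
      also have "\<dots> \<le> (C * D) * N ^ (i + j) * (2 ^ i * 2 ^ j)"
      proof (intro mult_left_mono mult_mono)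
        have "real (Suc n) \<le> 2 ^ n" for n
          using of_nat_mono[OF Suc_leI[OF less_exp[of n]], where 'a = real] by simp
        then show "real (Suc i) \<le> 2 ^ i" "real (Suc j) \<le> 2 ^ j" by blast+
      qed (use N \<open>C > 0\<close> \<open>D > 0\<close> in auto)
      also have "\<dots> = (C * D) * (2 * N) ^ (i + j)"
        by (simp add: power_add power_mult_distrib)
      finally show ?thesis .
    qed
  qed
qed

lemma fps_conv_radius_pos_iff_geometric_bound:
  fixes G :: "complex fps"
  shows "fps_conv_radius G > 0 \<longleftrightarrow> (\<exists>C M. M > 0 \<and> (\<forall>n. norm (fps_nth G n) \<le> C * M ^ n))"
proof
  assume "fps_conv_radius G > 0"
  then obtain r where r: "r > 0" "ereal r < fps_conv_radius G"
    by (metis ereal_dense2 ereal_less(2))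
  then have "summable (\<lambda>n. norm (fps_nth G n * of_real r ^ n))"
    by (intro abs_summable_in_conv_radius) (simp add: fps_conv_radius_def)
  then obtain C where C: "\<And>n. norm (fps_nth G n * of_real r ^ n) \<le> C"
    by (auto elim!: BseqE dest!: summable_imp_Bseq) blast
  have "norm (fps_nth G n) \<le> C * (1 / r) ^ n" for n
    using C[of n] r by (simp add: norm_mult norm_power field_simps)
  with r show "\<exists>C M. M > 0 \<and> (\<forall>n. norm (fps_nth G n) \<le> C * M ^ n)"
    by (intro exI[of _ C] exI[of _ "1 / r"]) auto
next
  assume "\<exists>C M. M > 0 \<and> (\<forall>n. norm (fps_nth G n) \<le> C * M ^ n)"
  then obtain C M where M: "M > 0" and C: "\<And>n. norm (fps_nth G n) \<le> C * M ^ n" by blast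
  define z :: complex where "z = of_real (1 / (2 * M))"
  have "summable (\<lambda>n. fps_nth G n * z ^ n)"
  proof (rule summable_comparison_test')
    show "summable (\<lambda>n. C * (1 / 2 :: real) ^ n)" by (intro summable_mult) simp
    show "norm (fps_nth G n * z ^ n) \<le> C * (1 / 2) ^ n" for n
    proof -
      have "norm (fps_nth G n * z ^ n) \<le> C * M ^ n * (1 / (2 * M)) ^ n"
        unfolding norm_mult norm_power z_def norm_of_real using M
        by (intro mult_mono C) (auto intro: order_trans[OF norm_ge_zero C])
      also have "\<dots> = C * (M * (1 / (2 * M))) ^ n"
        by (simp only: power_mult_distrib mult.assoc)
      also have "\<dots> = C * (1 / 2) ^ n"
        using M by simp
      finally show ?thesis .
    qed
  qed
  then have "norm z \<le> fps_conv_radius G"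
    unfolding fps_conv_radius_def by (rule conv_radius_geI)
  moreover have "norm z > 0" using M by (simp add: z_def)
  ultimately show "fps_conv_radius G > 0"
    by (metis ereal_less(2) less_le_trans)
qed

lemma convergent_fps2_fps_const:
  assumes "fps_conv_radius G > 0"
  shows "convergent_fps2 (fps_const G)"
proof -
  obtain C M where "M > 0" and C: "\<And>n. norm (fps_nth G n) \<le> C * M ^ n"
    using assms unfolding fps_conv_radius_pos_iff_geometric_bound by blast
  have "C \<ge> 0" using C[of 0] by (simp add: order_trans[OF norm_ge_zero])
  with \<open>M > 0\<close> C show ?thesis
    by (intro convergent_fps2I[of M _ C]) auto
qed

lemma fps_conv_radius_fps_nth_pos:
  assumes "convergent_fps2 P"
  shows "fps_conv_radius (fps_nth P i) > 0"
proof -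
  obtain C M where "C > 0" "M \<ge> 1"
    and C: "\<And>N i j. N \<ge> M \<Longrightarrow> norm (fps_nth (fps_nth P i) j) \<le> C * N ^ (i + j)"
    using assms by (rule convergent_fps2E) blast
  have "norm (fps_nth (fps_nth P i) j) \<le> (C * M ^ i) * M ^ j" for j
    using C[of M i j] by (simp add: power_add mult_ac)
  with \<open>M \<ge> 1\<close> show ?thesis
    unfolding fps_conv_radius_pos_iff_geometric_bound by (intro exI[of _ "C * M ^ i"] exI[of _ M]) auto
qed

lemma convergent_fps2_fps_X: "convergent_fps2 fps_X"
  by (rule convergent_fps2I[of 1 _ 1]) (auto simp: fps_X_def)

lemma convergent_fps2_scalar: "convergent_fps2 (fps_const (fps_const c))"
  by (rule convergent_fps2_fps_const) simp

lemma convergent_fps2_1: "convergent_fps2 1"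
  using convergent_fps2_scalar[of 1] by simp

lemma convergent_fps2_0: "convergent_fps2 0"
  using convergent_fps2_scalar[of 0] by simp

lemma convergent_fps2_uminus:
  "convergent_fps2 P \<Longrightarrow> convergent_fps2 (- P)"
  using convergent_fps2_mult[OF convergent_fps2_scalar[of "- 1"], of P]
  by (simp flip: fps_const_neg)

lemma convergent_fps2_fps_X_power: "convergent_fps2 (fps_X ^ n)"
  by (induction n) (simp_all add: convergent_fps2_1 convergent_fps2_fps_X convergent_fps2_mult)

text \<open>
  Division of a series by \<open>x\<^sup>a y\<^sup>b\<close>, discarding the terms that are not divisible.
\<close>

lemma convergent_fps2_shift:
  assumes "convergent_fps2 P"
  shows "convergent_fps2 (Abs_fps (\<lambda>i. fps_shift b (fps_nth P (i + a))))"
proof -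
  obtain C M where "C > 0" "M \<ge> 1"
    and C: "\<And>N i j. N \<ge> M \<Longrightarrow> norm (fps_nth (fps_nth P i) j) \<le> C * N ^ (i + j)"
    using assms by (rule convergent_fps2E) blast
  have "norm (fps_nth (fps_nth P (i + a)) (j + b)) \<le> (C * M ^ (a + b)) * M ^ (i + j)" for i j
    using C[of M "i + a" "j + b"] by (simp add: power_add mult_ac)
  with \<open>M \<ge> 1\<close> show ?thesis
    by (intro convergent_fps2I[of M _ "C * M ^ (a + b)"]) auto
qed

text \<open>
  The restriction to \<open>y = 0\<close>, divided by \<open>x\<^sup>a\<close> after its lower terms are discarded.
\<close>

lemma convergent_fps2_on_x_axis:
  assumes "convergent_fps2 P"
  shows "convergent_fps2 (Abs_fps (\<lambda>i. fps_const (fps_nth (fps_nth P (i + a)) 0)))"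
proof -
  obtain C M where "C > 0" "M \<ge> 1"
    and C: "\<And>N i j. N \<ge> M \<Longrightarrow> norm (fps_nth (fps_nth P i) j) \<le> C * N ^ (i + j)"
    using assms by (rule convergent_fps2E) blast
  have "norm (fps_nth (fps_const (fps_nth (fps_nth P (i + a)) 0)) j) \<le> (C * M ^ a) * M ^ (i + j)" for i j
    using C[of M "i + a" 0] \<open>C > 0\<close> \<open>M \<ge> 1\<close> by (cases j) (auto simp: power_add mult_ac)
  with \<open>M \<ge> 1\<close> show ?thesis
    by (intro convergent_fps2I[of M _ "C * M ^ a"]) auto
qed

section \<open>The ring of convergent power series\<close>

lemma conv_series_ring_simps [simp]:
  "carrier conv_series_ring = {P. convergent_fps2 P}"
  "x \<otimes>\<^bsub>conv_series_ring\<^esub> y = x * y"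
  "x \<oplus>\<^bsub>conv_series_ring\<^esub> y = x + y"
  "\<one>\<^bsub>conv_series_ring\<^esub> = 1"
  "\<zero>\<^bsub>conv_series_ring\<^esub> = 0"
  by (simp_all add: conv_series_ring_def)

lemma cring_conv_series_ring: "cring conv_series_ring"
proof (intro cringI abelian_groupI comm_monoidI)
  fix P assume "P \<in> carrier conv_series_ring"
  then show "\<exists>Q\<in>carrier conv_series_ring. Q \<oplus>\<^bsub>conv_series_ring\<^esub> P = \<zero>\<^bsub>conv_series_ring\<^esub>"
    by (intro bexI[of _ "- P"]) (auto intro: convergent_fps2_uminus)
qed (auto simp: algebra_simps convergent_fps2_add convergent_fps2_mult
    convergent_fps2_1 convergent_fps2_0)

interpretation conv: cring conv_series_ring
  by (rule cring_conv_series_ring)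

lemma conv_a_inv: "convergent_fps2 P \<Longrightarrow> \<ominus>\<^bsub>conv_series_ring\<^esub> P = - P"
  by (intro conv.minus_equality) (auto intro: convergent_fps2_uminus)

lemma conv_a_minus:
  "convergent_fps2 P \<Longrightarrow> convergent_fps2 Q \<Longrightarrow> P \<ominus>\<^bsub>conv_series_ring\<^esub> Q = P - Q"
  by (simp add: a_minus_def conv_a_inv)

section \<open>Dimension of a quotient by a common kernel\<close>

text \<open>
  If the ideal is the common kernel of \<open>d\<close> linear functionals that admit a dual family
  \<open>e\<close>, these functionals identify the quotient with the space of \<open>d\<close>-tuples, so its
  dimension is \<open>d\<close>. The required flag of subspaces is \<open>E n\<close>, the classes on which the functionals
  with index at least \<open>n\<close> vanish: the class of \<open>e n\<close> enlarges \<open>E n\<close> to \<open>E (n + 1)\<close>.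
\<close>

lemma dimension_quotient_by_functionals:
  fixes L :: "nat \<Rightarrow> complex fps fps \<Rightarrow> complex"
  assumes ideal: "ideal I conv_series_ring"
    and I: "I = {P. convergent_fps2 P \<and> (\<forall>i<d. L i P = 0)}"
    and L_add: "\<And>i P Q. L i (P + Q) = L i P + L i Q"
    and L_scale: "\<And>i c P. L i (fps_const (fps_const c) * P) = c * L i P"
    and e_conv: "\<And>n. convergent_fps2 (e n)"
    and dual: "\<And>i n. i < d \<Longrightarrow> n < d \<Longrightarrow> L i (e n) = (if i = n then 1 else 0)"
  shows "ring.dimension (conv_series_ring Quot I) d (quotient_scalars I)
    (carrier (conv_series_ring Quot I))"
proof -
  define Q where "Q = conv_series_ring Quot I"
  define \<pi> where "\<pi> = (\<lambda>P. I +>\<^bsub>conv_series_ring\<^esub> P)"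
  interpret h: ring_hom_ring conv_series_ring Q \<pi>
    unfolding Q_def \<pi>_def by (rule ideal.rcos_ring_hom_ring[OF ideal])
  have carrier_Q: "carrier Q = \<pi> ` {P. convergent_fps2 P}"
    by (auto simp: Q_def \<pi>_def FactRing_def A_RCOSETS_defs a_r_coset_def)
  have scalars: "quotient_scalars I = range (\<lambda>c. \<pi> (fps_const (fps_const c)))"
    by (simp add: quotient_scalars_def \<pi>_def)
  have L_minus: "L i (P - S) = L i P - L i S" for i P S
    using L_add[of i P "fps_const (fps_const (- 1)) * S"] L_scale[of i "- 1" S]
    by (simp flip: fps_const_neg)
  have pi_eq: "\<pi> P = \<pi> S \<longleftrightarrow> (\<forall>i<d. L i P = L i S)"
    if "convergent_fps2 P" "convergent_fps2 S" for P S
  proof -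
    have "convergent_fps2 (P - S)"
      using convergent_fps2_add[OF that(1) convergent_fps2_uminus[OF that(2)]] by simp
    then have "P - S \<in> I \<longleftrightarrow> (\<forall>i<d. L i P = L i S)"
      by (auto simp: I L_minus)
    moreover have "P - S \<in> I \<longleftrightarrow> \<pi> P = \<pi> S"
      using conv.quotient_eq_iff_same_a_r_cos[OF ideal, of P S] that
      by (simp add: conv_a_minus \<pi>_def)
    ultimately show ?thesis by blast
  qed
  define E where "E n = \<pi> ` {P. convergent_fps2 P \<and> (\<forall>i<d. n \<le> i \<longrightarrow> L i P = 0)}" for n
  have "h.S.dimension n (quotient_scalars I) (E n)" if "n \<le> d" for n
    using that
  proof (induction n)
    case 0
    have "E 0 = {\<zero>\<^bsub>Q\<^esub>}"
    proof -
      have "\<pi> 0 = \<zero>\<^bsub>Q\<^esub>" using h.hom_zero by simp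
      moreover have "\<pi> P = \<pi> 0" if "convergent_fps2 P" "\<forall>i<d. L i P = 0" for P
      proof -
        have "L i 0 = 0" for i using L_minus[of i P P] by simp
        with that show ?thesis by (simp add: pi_eq convergent_fps2_0)
      qed
      moreover have "0 \<in> {P. convergent_fps2 P \<and> (\<forall>i<d. L i P = 0)}"
        using L_minus[of _ 0 0] by (simp add: convergent_fps2_0)
      ultimately show ?thesis unfolding E_def by (auto intro!: image_eqI[of _ \<pi> 0])
    qed
    then show ?case by (simp add: h.S.dimension.zero_dim)
  next
    case (Suc n)
    then have n: "n < d" by simp
    have not_in: "\<pi> (e n) \<notin> E n"
    proof
      assume "\<pi> (e n) \<in> E n"
      then obtain P where "convergent_fps2 P" "\<forall>i<d. n \<le> i \<longrightarrow> L i P = 0" "\<pi> (e n) = \<pi> P"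
        by (auto simp: E_def)
      with n show False by (auto simp: pi_eq e_conv dual)
    qed
    have "E (Suc n) = h.S.line_extension (quotient_scalars I) (\<pi> (e n)) (E n)"
    proof (intro Set.set_eqI iffI)
      fix u assume "u \<in> E (Suc n)"
      then obtain P where P: "convergent_fps2 P" "\<forall>i<d. Suc n \<le> i \<longrightarrow> L i P = 0" "u = \<pi> P"
        by (auto simp: E_def)
      \<comment> \<open>The component of P along e n; subtracting it kills the functional with index n.\<close>
      define T where "T = fps_const (fps_const (L n P)) * e n"
      have T: "convergent_fps2 T" "convergent_fps2 (P - T)"
        using convergent_fps2_mult[OF convergent_fps2_scalar e_conv[of n]]
          convergent_fps2_add[OF P(1) convergent_fps2_uminus] by (simp_all add: T_def)
      have "L i (P - T) = 0" if "i < d" "n \<le> i" for i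
        using that P(2) n by (cases "i = n") (simp_all add: L_minus T_def L_scale dual)
      then have "\<pi> (P - T) \<in> E n" using T by (auto simp: E_def)
      moreover have "u = \<pi> (fps_const (fps_const (L n P))) \<otimes>\<^bsub>Q\<^esub> \<pi> (e n) \<oplus>\<^bsub>Q\<^esub> \<pi> (P - T)"
        using h.hom_mult[of "fps_const (fps_const (L n P))" "e n"] h.hom_add[of T "P - T"] T P(3)
        by (simp add: convergent_fps2_scalar e_conv T_def)
      ultimately show "u \<in> h.S.line_extension (quotient_scalars I) (\<pi> (e n)) (E n)"
        unfolding h.S.line_extension_mem_iff scalars by blast
    next
      fix u assume "u \<in> h.S.line_extension (quotient_scalars I) (\<pi> (e n)) (E n)"
      then obtain c P where P: "convergent_fps2 P" "\<forall>i<d. n \<le> i \<longrightarrow> L i P = 0"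
        and u: "u = \<pi> (fps_const (fps_const c)) \<otimes>\<^bsub>Q\<^esub> \<pi> (e n) \<oplus>\<^bsub>Q\<^esub> \<pi> P"
        unfolding h.S.line_extension_mem_iff scalars E_def by blast
      define T where "T = fps_const (fps_const c) * e n"
      have T: "convergent_fps2 T" "convergent_fps2 (T + P)"
        using convergent_fps2_mult[OF convergent_fps2_scalar e_conv[of n]] 
          convergent_fps2_add[OF _ P(1)] by (simp_all add: T_def)
      have "u = \<pi> (T + P)"
        using h.hom_mult[of "fps_const (fps_const c)" "e n"] h.hom_add[of T P] T P(1) u
        by (simp add: convergent_fps2_scalar e_conv T_def)
      moreover have "\<forall>i<d. Suc n \<le> i \<longrightarrow> L i (T + P) = 0"
        using P(2) n by (simp add: L_add T_def L_scale dual)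
      ultimately show "u \<in> E (Suc n)" using T unfolding E_def by blast
    qed
    moreover have "\<pi> (e n) \<in> carrier Q" by (auto simp: carrier_Q e_conv)
    ultimately show ?case using Suc n not_in by (simp add: h.S.dimension.Suc_dim)
  qed
  from this[of d] have "h.S.dimension d (quotient_scalars I) (carrier Q)"
    by (simp add: E_def carrier_Q)
  then show ?thesis by (simp add: Q_def)
qed

section \<open>The ideal of the vector field\<close>

text \<open>
  Modulo \<open>F\<^sub>1 = c x\<^sup>2 + \<Psi>(y)\<close> and \<open>F\<^sub>2 = - x y\<close> the monomials \<open>x\<^sup>3\<close>, \<open>x y\<close> and \<open>y\<^sup>2\<close> vanish, and
  \<open>y\<close> becomes the multiple \<open>- (c / \<psi>\<^sub>1) x\<^sup>2\<close>, where \<open>\<psi>\<^sub>1\<close> is the linear coefficient of \<open>\<Psi>\<close>.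
  So membership only constrains the coefficients of \<open>1\<close>, \<open>x\<close>, \<open>x\<^sup>2\<close> and \<open>y\<close>.

  For the converse inclusion a series \<open>P\<close> in the right-hand side is written explicitly as
  \<open>A F\<^sub>1 + B F\<^sub>2\<close>. As \<open>F\<^sub>2\<close> vanishes exactly on the two axes, \<open>A\<close> has to satisfy
  \<open>A(0, y) = P(0, y) / \<Psi>(y)\<close> and \<open>A(x, 0) = P(x, 0) / (c x\<^sup>2)\<close>. Both quotients are
  convergent power series, and the condition on \<open>x\<^sup>2\<close> and \<open>y\<close> says that they agree at the
  origin. Then \<open>P - A F\<^sub>1\<close> vanishes on both axes and is divisible by \<open>x y\<close>.
\<close>

lemma ideal_of_field_components:
  fixes \<Psi> :: "complex fps" and c :: complex
  assumes \<Psi>0: "fps_nth \<Psi> 0 = 0" and \<Psi>1: "fps_nth \<Psi> 1 \<noteq> 0"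
    and \<Psi>_conv: "fps_conv_radius \<Psi> > 0" and c: "c \<noteq> 0"
  defines "F\<^sub>1 \<equiv> fps_const (fps_const c) * fps_X\<^sup>2 + fps_const \<Psi>"
    and "F\<^sub>2 \<equiv> - (fps_X * fps_const fps_X)"
  shows "Idl\<^bsub>conv_series_ring\<^esub> {F\<^sub>1, F\<^sub>2} =
    {P. convergent_fps2 P \<and> fps_nth (fps_nth P 0) 0 = 0 \<and> fps_nth (fps_nth P 1) 0 = 0 \<and>
      fps_nth (fps_nth P 2) 0 = c / fps_nth \<Psi> 1 * fps_nth (fps_nth P 0) 1}"
    (is "_ = ?K")
proof
  have F1: "convergent_fps2 F\<^sub>1" and F2: "convergent_fps2 F\<^sub>2"
    unfolding F\<^sub>1_def F\<^sub>2_def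
    by (intro convergent_fps2_add convergent_fps2_mult convergent_fps2_uminus convergent_fps2_scalar
      convergent_fps2_fps_X_power convergent_fps2_fps_X convergent_fps2_fps_const \<Psi>_conv; simp)+
  have "ideal ?K conv_series_ring"
  proof (rule idealI)
    show "ring conv_series_ring" by (rule conv.ring_axioms)
    show "subgroup ?K (add_monoid conv_series_ring)"
    proof (rule conv.add.subgroupI)
      show "?K \<noteq> {}" by (auto intro!: exI[of _ 0] convergent_fps2_0)
    qed (auto simp: convergent_fps2_add convergent_fps2_uminus conv_a_inv distrib_left add_divide_distrib)
    show "x \<otimes>\<^bsub>conv_series_ring\<^esub> a \<in> ?K" "a \<otimes>\<^bsub>conv_series_ring\<^esub> x \<in> ?K"
      if "a \<in> ?K" "x \<in> carrier conv_series_ring" for a x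
      using that
      by (auto simp: convergent_fps2_mult fps_mult_nth numeral_2_eq_2 algebra_simps)
  qed
  moreover have "{F\<^sub>1, F\<^sub>2} \<subseteq> ?K"
    using F1 F2 \<Psi>0 \<Psi>1 by (auto simp: F\<^sub>1_def F\<^sub>2_def fps_X_power_iff)
  ultimately show "Idl\<^bsub>conv_series_ring\<^esub> {F\<^sub>1, F\<^sub>2} \<subseteq> ?K"
    by (rule conv.genideal_minimal)
  show "?K \<subseteq> Idl\<^bsub>conv_series_ring\<^esub> {F\<^sub>1, F\<^sub>2}"
  proof
    fix P assume "P \<in> ?K"
    then have P: "convergent_fps2 P" and P00: "fps_nth (fps_nth P 0) 0 = 0"
      and P10: "fps_nth (fps_nth P (Suc 0)) 0 = 0"
      and P20: "fps_nth (fps_nth P 2) 0 = c / fps_nth \<Psi> 1 * fps_nth (fps_nth P 0) 1"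
      by auto
    \<comment> \<open>U is the unit with \<Psi> = y U, so that G = P(0, y) / \<Psi>(y).\<close>
    define U where "U = fps_shift 1 \<Psi>"
    define G where "G = fps_shift 1 (fps_nth P 0) * inverse U"
    have \<Psi>_U: "\<Psi> = fps_X * U" and U0: "fps_nth U 0 \<noteq> 0"
      using \<Psi>0 \<Psi>1 by (auto simp: U_def fps_eq_iff)
    have G_\<Psi>: "G * \<Psi> = fps_nth P 0"
    proof -
      have "G * \<Psi> = fps_X * fps_shift 1 (fps_nth P 0) * (inverse U * U)"
        by (simp only: G_def \<Psi>_U mult_ac)
      also have "\<dots> = fps_nth P 0"
        using P00 U0 by (simp add: inverse_mult_eq_1 fps_eq_iff)
      finally show ?thesis .
    qed
    have G0: "fps_nth G 0 = fps_nth (fps_nth P 0) 1 / fps_nth \<Psi> 1"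
      by (simp add: G_def U_def field_simps)
    have "fps_conv_radius (inverse U) > 0"
      using U0 \<Psi>_conv by (intro fps_conv_radius_inverse_pos) (auto simp: U_def)
    then have G_conv: "fps_conv_radius G > 0"
      unfolding G_def using fps_conv_radius_fps_nth_pos[OF P, of 0]
      by (intro less_le_trans[OF _ fps_conv_radius_mult]) simp
    \<comment> \<open>G(y) + (P(x, 0) / (c x^2) - G(0)); the second summand starts with the coefficient of x^3 in P.\<close>
    define A where "A = fps_const G + fps_const (fps_const (1 / c)) *
      (fps_X * Abs_fps (\<lambda>i. fps_const (fps_nth (fps_nth P (i + 3)) 0)))"
    have A_conv: "convergent_fps2 A"
      unfolding A_def
      by (intro convergent_fps2_add convergent_fps2_mult convergent_fps2_fps_X convergent_fps2_scalar
        convergent_fps2_fps_const G_conv convergent_fps2_on_x_axis P)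
    define D where "D = P - A * F\<^sub>1"
    have D_conv: "convergent_fps2 D"
      using convergent_fps2_add[OF P convergent_fps2_uminus[OF convergent_fps2_mult[OF A_conv F1]]]
      by (simp add: D_def)
    have A_nth: "fps_nth A i = (if i = 0 then G else fps_const (fps_nth (fps_nth P (i + 2)) 0 / c))" for i
      by (auto simp: A_def fps_eq_iff numeral_2_eq_2 numeral_3_eq_3)
    have AF_nth: "fps_nth (A * F\<^sub>1) i =
        fps_const c * (if i < 2 then 0 else fps_nth A (i - 2)) + fps_nth A i * \<Psi>" for i
    proof -
      have "A * F\<^sub>1 = fps_const (fps_const c) * (fps_X ^ 2 * A) + A * fps_const \<Psi>"
        by (simp add: F\<^sub>1_def algebra_simps)
      then show ?thesis by (simp add: fps_X_power_mult_nth)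
    qed
    have D_nth: "fps_nth D i = fps_nth P i -
        (fps_const c * (if i < 2 then 0 else fps_nth A (i - 2)) + fps_nth A i * \<Psi>)" for i
      by (simp only: D_def fps_sub_nth AF_nth)
    have D0: "fps_nth D 0 = 0"
      by (simp add: D_nth A_nth G_\<Psi>)
    \<comment> \<open>The case i = 2 is where the relation between the coefficients of x^2 and y enters.\<close>
    have D_x: "fps_nth (fps_nth D i) 0 = 0" for i
    proof -
      consider "i = 0" | "i = 1" | "i = 2" | k where "i = k + 3"
        using le_Suc_ex[of 3 i] by (cases "i < 3") (fastforce simp: add.commute)+
      then show ?thesis
        by cases (use c P10 P20 \<Psi>0 in \<open>simp_all add: P00 D_nth A_nth G0 numeral_3_eq_3\<close>)
    qed
    define B where "B = - Abs_fps (\<lambda>i. fps_shift 1 (fps_nth D (i + 1)))"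
    have B_conv: "convergent_fps2 B"
      unfolding B_def by (intro convergent_fps2_uminus convergent_fps2_shift D_conv)
    have "fps_nth (fps_nth (B * F\<^sub>2) i) j = fps_nth (fps_nth D i) j" for i j
    proof -
      have "B * F\<^sub>2 = fps_X * (fps_const fps_X * (- B))"
        by (simp add: F\<^sub>2_def algebra_simps)
      then show ?thesis
        using D0 D_x by (cases i; cases j) (simp_all add: B_def)
    qed
    then have "B * F\<^sub>2 = D" by (simp add: fps_eq_iff)
    then have P_eq: "P = A * F\<^sub>1 + B * F\<^sub>2" by (simp add: D_def)
    have gen: "{F\<^sub>1, F\<^sub>2} \<subseteq> carrier conv_series_ring" using F1 F2 by simp
    interpret J: ideal "Idl\<^bsub>conv_series_ring\<^esub> {F\<^sub>1, F\<^sub>2}" conv_series_ring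
      by (rule conv.genideal_ideal[OF gen])
    have "F\<^sub>1 \<in> Idl\<^bsub>conv_series_ring\<^esub> {F\<^sub>1, F\<^sub>2}" "F\<^sub>2 \<in> Idl\<^bsub>conv_series_ring\<^esub> {F\<^sub>1, F\<^sub>2}"
      using conv.genideal_self[OF gen] by auto
    then show "P \<in> Idl\<^bsub>conv_series_ring\<^esub> {F\<^sub>1, F\<^sub>2}"
      using J.a_closed[OF J.I_l_closed[of F\<^sub>1 A] J.I_l_closed[of F\<^sub>2 B]] A_conv B_conv
      by (simp add: P_eq)
  qed
qed

section \<open>Expansions of functions of two real variables\<close>

lemma has_conv_expansion2_add:
  assumes "has_conv_expansion2 f P" and "has_conv_expansion2 g Q"
  shows "has_conv_expansion2 (\<lambda>p. f p + g p) (P + Q)"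
proof -
  have "\<forall>\<^sub>F p in nhds 0.
      ((\<lambda>(i, j). fps_nth (fps_nth (P + Q) i) j * of_real ((p $ 1) ^ i * (p $ 2) ^ j))
        has_sum of_real (f p + g p)) UNIV"
    using conjunct2[OF assms(1)[unfolded has_conv_expansion2_def]]
      conjunct2[OF assms(2)[unfolded has_conv_expansion2_def]]
  proof eventually_elim
    case (elim p)
    show ?case
      using has_sum_add[OF elim] by (simp add: split_def distrib_right)
  qed
  with assms show ?thesis
    by (simp add: has_conv_expansion2_def convergent_fps2_add)
qed

lemma has_conv_expansion2_monomial:
  "has_conv_expansion2 (\<lambda>p. c * (p $ 1) ^ a * (p $ 2) ^ b)
    (fps_const (fps_const (of_real c)) * fps_X ^ a * fps_const (fps_X ^ b))"
proof -
  define P :: "complex fps fps"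
    where "P = fps_const (fps_const (of_real c)) * fps_X ^ a * fps_const (fps_X ^ b)"
  have "convergent_fps2 P"
    unfolding P_def
    by (intro convergent_fps2_mult convergent_fps2_scalar convergent_fps2_fps_X_power
        convergent_fps2_fps_const) simp
  moreover have nth: "fps_nth (fps_nth P i) j = (if i = a \<and> j = b then of_real c else 0)" for i j
    by (cases "i = a") (simp_all add: P_def fps_X_power_iff)
  have "((\<lambda>(i, j). fps_nth (fps_nth P i) j * of_real ((p $ 1) ^ i * (p $ 2) ^ j))
      has_sum of_real (c * (p $ 1) ^ a * (p $ 2) ^ b)) UNIV" for p :: "real^2"
    by (rule has_sum_finite_neutralI[of "{(a, b)}"]) (auto simp: nth split: if_splits)
  ultimately show ?thesis by (simp add: has_conv_expansion2_def flip: P_def)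
qed

text \<open>
  The real expansion of \<open>\<psi>\<close>, with its coefficients embedded in \<open>\<complex>\<close>, is an expansion of
  \<open>(x, y) \<mapsto> \<psi>(y)\<close>: only the coefficients with \<open>i = 0\<close> are nonzero, so the double sum is the
  single sum over \<open>{0} \<times> \<nat>\<close>.
\<close>

lemma has_conv_expansion2_of_snd:
  fixes F :: "real fps"
  assumes "\<psi> has_fps_expansion F"
  defines "\<Psi> \<equiv> Abs_fps (\<lambda>n. complex_of_real (fps_nth F n))"
  shows "fps_conv_radius \<Psi> > 0"
    and "has_conv_expansion2 (\<lambda>p. \<psi> (p $ 2)) (fps_const \<Psi>)"
proof -
  have radius: "fps_conv_radius F > 0" and ev: "\<forall>\<^sub>F y in nhds 0. eval_fps F y = \<psi> y"
    using assms(1) by (auto simp: has_fps_expansion_def)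
  have "fps_conv_radius \<Psi> = fps_conv_radius F"
    unfolding fps_conv_radius_def conv_radius_def by (simp add: \<Psi>_def)
  with radius show \<Psi>_radius: "fps_conv_radius \<Psi> > 0" by simp
  have "\<forall>\<^sub>F y in nhds 0. y \<in> eball 0 (fps_conv_radius F)"
    using radius by (intro eventually_nhds_in_open) (auto simp: zero_ereal_def)
  with ev have "\<forall>\<^sub>F y in nhds 0. eval_fps F y = \<psi> y \<and> norm y < fps_conv_radius F"
    by eventually_elim auto
  moreover have "filterlim (\<lambda>p :: real^2. p $ 2) (nhds 0) (nhds 0)"
    using tendsto_vec_nth[OF filterlim_ident[of "nhds (0 :: real^2)"], of 2] by simp
  ultimately have "\<forall>\<^sub>F p :: real^2 in nhds 0.
      eval_fps F (p $ 2) = \<psi> (p $ 2) \<and> norm (p $ 2) < fps_conv_radius F"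
    by (rule eventually_compose_filterlim)
  then have "\<forall>\<^sub>F p :: real^2 in nhds 0.
      ((\<lambda>(i, j). fps_nth (fps_nth (fps_const \<Psi>) i) j * of_real ((p $ 1) ^ i * (p $ 2) ^ j))
        has_sum of_real (\<psi> (p $ 2))) UNIV"
  proof eventually_elim
    case (elim p)
    have "((\<lambda>n. fps_nth F n * (p $ 2) ^ n) has_sum \<psi> (p $ 2)) UNIV"
      using elim abs_summable_in_conv_radius[of "p $ 2" "fps_nth F"] sums_eval_fps[of "p $ 2" F]
      by (intro norm_summable_imp_has_sum) (auto simp: fps_conv_radius_def)
    then have "((\<lambda>n. of_real (fps_nth F n * (p $ 2) ^ n)) has_sum complex_of_real (\<psi> (p $ 2))) UNIV"
      by (rule has_sum_of_real)
    then have "((\<lambda>(i, j). fps_nth (fps_nth (fps_const \<Psi>) i) j * of_real ((p $ 1) ^ i * (p $ 2) ^ j))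
        has_sum complex_of_real (\<psi> (p $ 2))) (Pair 0 ` UNIV)"
      by (subst has_sum_reindex) (auto simp: inj_on_def o_def \<Psi>_def)
    then show ?case
      by (rule has_sum_cong_neutral[THEN iffD1, rotated -1]) (auto simp: image_iff)
  qed
  with \<Psi>_radius show "has_conv_expansion2 (\<lambda>p. \<psi> (p $ 2)) (fps_const \<Psi>)"
    by (simp add: has_conv_expansion2_def convergent_fps2_fps_const)
qed

lemma has_fps_expansion_has_field_derivative:
  fixes f :: "'a :: {banach, real_normed_field} \<Rightarrow> 'a"
  assumes "f has_fps_expansion F"
  shows "\<forall>\<^sub>F z in nhds 0. (f has_field_derivative eval_fps (fps_deriv F) z) (at z)"
proof -
  have radius: "fps_conv_radius F > 0" and ev: "\<forall>\<^sub>F z in nhds 0. eval_fps F z = f z"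
    using assms by (auto simp: has_fps_expansion_def)
  have "\<forall>\<^sub>F z in nhds 0. z \<in> eball 0 (fps_conv_radius F)"
    using radius by (intro eventually_nhds_in_open) (auto simp: zero_ereal_def)
  moreover have "\<forall>\<^sub>F z in nhds 0. \<forall>\<^sub>F w in nhds z. eval_fps F w = f w"
    using ev by (simp add: eventually_eventually)
  ultimately show ?thesis
  proof eventually_elim
    case (elim z)
    then have "(eval_fps F has_field_derivative eval_fps (fps_deriv F) z) (at z)"
      by (intro has_field_derivative_eval_fps) auto
    then show ?case
      using DERIV_cong_ev[OF refl elim(2) refl] by blast
  qed
qed

section \<open>The local multiplicity\<close>

text \<open>
  The functionals are the coefficient of \<open>1\<close>, the coefficient of \<open>x\<close>, and the coefficient of
  \<open>x\<^sup>2\<close> corrected by the multiple of the coefficient of \<open>y\<close> that makes it vanish on \<open>F\<^sub>1\<close>;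
  they are dual to \<open>1, x, x\<^sup>2\<close>.
\<close>

lemma multiplicity_planar_field:
  assumes "m \<noteq> 1" and F: "\<psi> has_fps_expansion F"
    and "fps_nth F 0 = 0" and "fps_nth F 1 \<noteq> 0"
  shows "has_local_multiplicity (planar_field m \<psi>) 3"
proof -
  define c :: complex where "c = of_real ((1 - m) / 2)"
  define \<Psi> where "\<Psi> = Abs_fps (\<lambda>n. complex_of_real (fps_nth F n))"
  define F\<^sub>1 where "F\<^sub>1 = fps_const (fps_const c) * fps_X\<^sup>2 + fps_const \<Psi>"
  define F\<^sub>2 :: "complex fps fps" where "F\<^sub>2 = - (fps_X * fps_const fps_X)"
  define k where "k = c / fps_nth \<Psi> 1"
  define L where "L i P = (if i = 2 then fps_nth (fps_nth P 2) 0 - k * fps_nth (fps_nth P 0) 1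
    else fps_nth (fps_nth P i) 0)" for i and P :: "complex fps fps"
  define I where "I = Idl\<^bsub>conv_series_ring\<^esub> {F\<^sub>1, F\<^sub>2}"
  have \<Psi>_radius: "fps_conv_radius \<Psi> > 0"
    unfolding \<Psi>_def by (rule has_conv_expansion2_of_snd(1)[OF F])
  have "has_conv_expansion2 (\<lambda>p. planar_field m \<psi> p $ 1) F\<^sub>1"
    using has_conv_expansion2_add[OF has_conv_expansion2_monomial[of "(1 - m) / 2" 2 0]
        has_conv_expansion2_of_snd(2)[OF F]]
    by (simp add: planar_field_def F\<^sub>1_def c_def \<Psi>_def)
  moreover have "has_conv_expansion2 (\<lambda>p. planar_field m \<psi> p $ 2) F\<^sub>2"
    using has_conv_expansion2_monomial[of "- 1" 1 1]
    by (simp add: planar_field_def F\<^sub>2_def flip: fps_const_neg)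
  moreover have "ring.dimension (conv_series_ring Quot I) 3 (quotient_scalars I)
      (carrier (conv_series_ring Quot I))"
  proof (rule dimension_quotient_by_functionals[where L = L and e = "\<lambda>n. fps_X ^ n"])
    have I_eq: "I = {P. convergent_fps2 P \<and> fps_nth (fps_nth P 0) 0 = 0 \<and>
        fps_nth (fps_nth P 1) 0 = 0 \<and> fps_nth (fps_nth P 2) 0 = k * fps_nth (fps_nth P 0) 1}"
      unfolding I_def F\<^sub>1_def F\<^sub>2_def k_def
      by (rule ideal_of_field_components) (use assms \<Psi>_radius in \<open>simp_all add: \<Psi>_def c_def\<close>)
    then show "I = {P. convergent_fps2 P \<and> (\<forall>i<3. L i P = 0)}"
      by (auto simp: L_def numeral_3_eq_3 less_Suc_eq numeral_2_eq_2)
    have "{F\<^sub>1, F\<^sub>2} \<subseteq> carrier conv_series_ring"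
      using calculation by (simp add: has_conv_expansion2_def)
    then show "ideal I conv_series_ring"
      unfolding I_def by (rule conv.genideal_ideal)
    show "L i (fps_X ^ n) = (if i = n then 1 else 0)" if "i < 3" "n < 3" for i n
      using that by (auto simp: L_def fps_X_power_iff)
  qed (auto simp: L_def algebra_simps convergent_fps2_fps_X_power)
  ultimately show ?thesis
    unfolding has_local_multiplicity_def Let_def I_def by blast
qed

section \<open>Jacobian and directional derivatives\<close>

lemma matrix_vector_mult_2:
  fixes A :: "real^2^2"
  shows "A *v v = vector [A $ 1 $ 1 * v $ 1 + A $ 1 $ 2 * v $ 2, A $ 2 $ 1 * v $ 1 + A $ 2 $ 2 * v $ 2]"
  by (simp add: vec_eq_iff forall_2 matrix_vector_mult_def sum_2)

lemma jac_planar_field: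
  assumes "(\<psi> has_field_derivative d) (at (p $ 2))"
  shows "jac (planar_field m \<psi>) p = vector [vector [(1 - m) * p $ 1, d], vector [- (p $ 2), - (p $ 1)]]"
    (is "_ = ?J")
proof -
  have nth: "((\<lambda>p :: real^2. p $ k) has_derivative (\<lambda>h. h $ k)) (at p)" for k
    by (rule bounded_linear_imp_has_derivative[OF bounded_linear_vec_nth])
  have "(planar_field m \<psi> has_derivative (\<lambda>h. ?J *v h)) (at p)"
  proof (subst has_derivative_componentwise_within, intro ballI)
    fix b :: "real^2" assume "b \<in> Basis"
    then obtain k where "b = axis k 1" by (auto simp: Basis_vec_def)
    then consider "b = axis 1 1" | "b = axis 2 1" using exhaust_2[of k] by blast
    then show "((\<lambda>q. planar_field m \<psi> q \<bullet> b) has_derivative (\<lambda>h. (?J *v h) \<bullet> b)) (at p)"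
    proof cases
      case 1
      have "((\<lambda>q. (1 - m) / 2 * (q $ 1)\<^sup>2 + \<psi> (q $ 2)) has_derivative
          (\<lambda>h. (1 - m) * p $ 1 * h $ 1 + d * h $ 2)) (at p)"
        using has_derivative_compose[OF nth assms[unfolded has_field_derivative_def]]
        by (auto intro!: derivative_eq_intros nth)
      then show ?thesis
        by (simp add: 1 inner_axis planar_field_def matrix_vector_mult_2)
    next
      case 2
      have "((\<lambda>q. - (q $ 1 * q $ 2)) has_derivative (\<lambda>h. - (p $ 2) * h $ 1 - p $ 1 * h $ 2)) (at p)"
        by (auto intro!: derivative_eq_intros nth)
      then show ?thesis
        by (simp add: 2 inner_axis planar_field_def matrix_vector_mult_2)
    qed
  qed
  from frechet_derivative_at[OF this] show ?thesis
    by (metis jac_def jacobian_def matrix_of_matrix_vector_mul)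
qed

lemma GDERIV_unique:
  assumes "GDERIV h p :> g" and "GDERIV h p :> g'"
  shows "g = g'"
proof -
  have "(\<lambda>x. x \<bullet> g) = (\<lambda>x. x \<bullet> g')"
    using assms unfolding gderiv_def by (rule has_derivative_unique)
  then show ?thesis by (metis vector_eq_ldot)
qed

text \<open>
  The Jacobian has a closed form only near the origin, where \<open>\<psi>\<close> is known to be differentiable;
  a directional derivative depends only on the germ of the function.
\<close>

lemma dir_deriv_eqI:
  fixes g :: "real^2"
  assumes "GDERIV f p :> g" and "\<forall>\<^sub>F q in nhds p. f q = h q"
  shows "dir_deriv v h p = g \<bullet> v"
proof -
  have "f p = h p" using assms(2) by (rule eventually_nhds_x_imp_x)
  moreover have "\<forall>\<^sub>F q in at p. f q = h q"
    using assms(2) unfolding eventually_at_filter by (rule eventually_mono) simp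
  ultimately have "GDERIV h p :> g"
    using assms(1) has_derivative_transform_eventually[of f _ p UNIV h]
    unfolding gderiv_def by simp
  then have "gradient h p = g"
    unfolding gradient_def by (intro the_equality) (auto intro: GDERIV_unique)
  then show ?thesis by (simp add: dir_deriv_def)
qed

lemma GDERIV_vec_nth: "GDERIV (\<lambda>p :: real^'n. p $ k) p :> axis k 1"
  unfolding gderiv_def
  by (simp add: inner_axis bounded_linear_imp_has_derivative[OF bounded_linear_vec_nth])

lemma eventually_nhds_vec_nth:
  assumes "\<forall>\<^sub>F y in nhds (p $ k). Q y"
  shows "\<forall>\<^sub>F q :: real^'n in nhds p. Q (q $ k)"
  using assms tendsto_vec_nth[OF filterlim_ident[of "nhds p"], of k]
  by (rule eventually_compose_filterlim)

section \<open>The nilpotent equilibrium\<close>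

theorem corollary5p2:
  fixes m :: real and \<psi> :: "real \<Rightarrow> real"
  assumes "m \<noteq> 1"
    and "\<exists>P. \<psi> has_fps_expansion P"
    and "\<psi> 0 = 0"
    and "deriv \<psi> 0 \<noteq> 0"
  shows "isolated_equilibrium (planar_field m \<psi>) 0 \<and>
    nilpotent_matrix (jac (planar_field m \<psi>) 0) \<and>
    rank (jac (planar_field m \<psi>) 0) = 1 \<and>
    {v. jac (planar_field m \<psi>) 0 *v v = 0} = span {vector [1, 0]} \<and>
    a_coeff (planar_field m \<psi>) (vector [1, 0]) = 0 \<and>
    b_coeff (planar_field m \<psi>) (vector [1, 0]) = - m \<and>
    has_local_multiplicity (planar_field m \<psi>) 3"
proof -
  obtain F where F: "\<psi> has_fps_expansion F" using assms(2) by blast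
  \<comment> \<open>g is the derivative of \<psi> near 0, as the sum of the differentiated series.\<close>
  define g where "g = eval_fps (fps_deriv F)"
  have deriv_ev: "\<forall>\<^sub>F y in nhds 0. (\<psi> has_field_derivative g y) (at y)"
    unfolding g_def by (rule has_fps_expansion_has_field_derivative[OF F])
  then have deriv0: "(\<psi> has_field_derivative g 0) (at 0)" by (rule eventually_nhds_x_imp_x)
  with assms(4) have g0: "g 0 \<noteq> 0" by (simp add: DERIV_imp_deriv)
  have "0 < fps_conv_radius (fps_deriv F)"
    using F fps_conv_radius_deriv[of F] by (auto simp: has_fps_expansion_def intro: less_le_trans)
  then obtain g' where g': "(g has_field_derivative g') (at 0)"
    unfolding g_def using has_field_derivative_eval_fps[of 0 "fps_deriv F" UNIV]
    by (auto simp: zero_ereal_def)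
  have "eval_fps F 0 = \<psi> 0"
    using F by (auto simp: has_fps_expansion_def dest: eventually_nhds_x_imp_x)
  with assms(3) have F0: "fps_nth F 0 = 0" by (simp add: eval_fps_at_0)
  have F1: "fps_nth F 1 \<noteq> 0" using g0 by (simp add: g_def eval_fps_at_0)
  let ?X = "planar_field m \<psi>"
  define J where "J = (\<lambda>p :: real^2. 
    vector [vector [(1 - m) * p $ 1, g (p $ 2)], vector [- (p $ 2), - (p $ 1)]] :: real^2^2)"
  have jac_ev: "\<forall>\<^sub>F p in nhds 0. jac ?X p = J p"
    using eventually_nhds_vec_nth[where p = "0 :: real^2" and k = 2, unfolded zero_index, OF deriv_ev]
    by eventually_elim (simp add: J_def jac_planar_field)
  then have jac0: "jac ?X 0 = vector [vector [0, g 0], vector [0, 0]]"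
    using eventually_nhds_x_imp_x[OF jac_ev] by (simp add: J_def)
  have jac0_v: "jac ?X 0 *v v = g 0 *\<^sub>R vector [v $ 2, 0]" for v
    by (simp add: jac0 matrix_vector_mult_2 vec_eq_iff forall_2)

  have "isolated_equilibrium ?X 0"
  proof -
    have "((\<lambda>y. \<psi> y / y) \<longlongrightarrow> g 0) (at 0)"
      using deriv0 assms(3) by (simp add: has_field_derivative_iff)
    then have "\<forall>\<^sub>F y in at 0. \<psi> y / y \<noteq> 0"
      by (rule tendsto_imp_eventually_ne) (rule g0)
    then have "\<forall>\<^sub>F y in nhds 0. \<psi> y = 0 \<longrightarrow> y = 0"
      by (auto simp: eventually_at_filter elim: eventually_mono)
    then have "\<forall>\<^sub>F p :: real^2 in nhds 0. \<psi> (p $ 2) = 0 \<longrightarrow> p $ 2 = 0"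
      using eventually_nhds_vec_nth[where p = "0 :: real^2" and k = 2] by simp
    then obtain S :: "(real^2) set" where S: "open S" "0 \<in> S" "\<forall>p\<in>S. \<psi> (p $ 2) = 0 \<longrightarrow> p $ 2 = 0"
      by (auto simp: eventually_nhds)
    \<comment> \<open>On x = 0 the first component is \<psi>(y); on y = 0 it is (1 - m) / 2 * x^2.\<close>
    have "p = 0" if "p \<in> S" "?X p = 0" for p
    proof -
      from that(2) have "p $ 1 = 0 \<or> p $ 2 = 0" "(1 - m) / 2 * (p $ 1)\<^sup>2 + \<psi> (p $ 2) = 0"
        by (auto simp: planar_field_def vec_eq_iff forall_2)
      with S(3) that(1) assms(1,3) have "p $ 1 = 0 \<and> p $ 2 = 0" by auto
      then show ?thesis by (simp add: vec_eq_iff forall_2)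
    qed
    moreover have "?X 0 = 0"
      by (simp add: planar_field_def vec_eq_iff forall_2 assms(3))
    ultimately have "S \<inter> {q. ?X q = 0} = {0}" using S(2) by auto
    with S(1) show ?thesis
      unfolding isolated_equilibrium_def isolated_in_def by blast
  qed
  moreover have "nilpotent_matrix (jac ?X 0)"
    unfolding nilpotent_matrix_def
    by (rule exI[of _ 2])
      (simp add: jac0 numeral_2_eq_2 matrix_matrix_mult_def vec_eq_iff forall_2 sum_2)
  moreover have "rank (jac ?X 0) = 1"
  proof -
    have "range (\<lambda>v. jac ?X 0 *v v) = span {vector [1, 0]}"
    proof (intro Set.set_eqI iffI)
      fix u assume "u \<in> range (\<lambda>v. jac ?X 0 *v v)"
      then obtain v :: "real^2" where "u = g 0 *\<^sub>R vector [v $ 2, 0]" by (auto simp: jac0_v)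
      then have "u = (g 0 * v $ 2) *\<^sub>R vector [1, 0]" by (simp add: vec_eq_iff forall_2)
      then show "u \<in> span {vector [1, 0]}" by (auto simp: span_singleton)
    next
      fix u :: "real^2" assume "u \<in> span {vector [1, 0]}"
      then obtain t where "u = t *\<^sub>R vector [1, 0]" by (auto simp: span_singleton)
      then have "u = jac ?X 0 *v vector [0, t / g 0]"
        using g0 by (simp add: jac0_v vec_eq_iff forall_2)
      then show "u \<in> range (\<lambda>v. jac ?X 0 *v v)" by blast
    qed
    moreover have "(vector [1, 0] :: real^2) \<noteq> 0" by (simp add: vec_eq_iff forall_2)
    ultimately show ?thesis
      by (simp add: rank_dim_range)
  qed
  moreover have "{v. jac ?X 0 *v v = 0} = span {vector [1, 0]}"
    using g0 by (auto simp: jac0_v vec_eq_iff forall_2 span_singleton)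
  moreover have "a_coeff ?X (vector [1, 0]) = 0"
  proof -
    \<comment> \<open>The gradient of det DX = - (1 - m) x^2 + y g(y) at 0 points in the y-direction.\<close>
    have g_y: "GDERIV (\<lambda>p. g (p $ 2)) (0 :: real^2) :> g' *\<^sub>R axis 2 1"
      by (rule GDERIV_DERIV_compose) (simp_all add: GDERIV_vec_nth g')
    have "GDERIV (\<lambda>p. (1 - m) * p $ 1 * (- (p $ 1)) - g (p $ 2) * (- (p $ 2))) (0 :: real^2)
        :> g 0 *\<^sub>R axis 2 1"
      by (rule GDERIV_subst,
          (rule GDERIV_diff GDERIV_mult GDERIV_minus GDERIV_const GDERIV_vec_nth g_y)+) simp
    moreover have "\<forall>\<^sub>F p in nhds 0.
        (1 - m) * p $ 1 * (- (p $ 1)) - g (p $ 2) * (- (p $ 2)) = det (jac ?X p)"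
      using jac_ev by eventually_elim (simp add: J_def det_2)
    ultimately have "dir_deriv (vector [1, 0]) (\<lambda>p. det (jac ?X p)) 0 =
        (g 0 *\<^sub>R axis 2 1 :: real^2) \<bullet> vector [1, 0]"
      by (rule dir_deriv_eqI)
    then show ?thesis by (simp add: a_coeff_def inner_axis')
  qed
  moreover have "b_coeff ?X (vector [1, 0]) = - m"
  proof -
    have "GDERIV (\<lambda>p. (1 - m) * p $ 1 - p $ 1) (0 :: real^2) :> ((1 - m) *\<^sub>R axis 1 1 - axis 1 1)"
      by (rule GDERIV_subst, (rule GDERIV_diff GDERIV_mult GDERIV_const GDERIV_vec_nth)+) simp
    moreover have "\<forall>\<^sub>F p in nhds 0. (1 - m) * p $ 1 - p $ 1 = trace (jac ?X p)"
      using jac_ev by eventually_elim (simp add: J_def trace_def sum_2)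
    ultimately have "dir_deriv (vector [1, 0]) (\<lambda>p. trace (jac ?X p)) 0 =
        ((1 - m) *\<^sub>R axis 1 1 - axis 1 1 :: real^2) \<bullet> vector [1, 0]"
      by (rule dir_deriv_eqI)
    then show ?thesis by (simp add: b_coeff_def inner_axis' inner_diff_left)
  qed
  moreover have "has_local_multiplicity ?X 3"
    using assms(1) F F0 F1 by (rule multiplicity_planar_field)
  ultimately show ?thesis by blast
qed

end
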